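(* Let $X$ be a complex Banach space with open unit ball $B$, let $H(B)$ be a uniform algebra with $A_u(B)\subseteq H(B)\subseteq H^\infty(B)$, let $x_0^{**}\in\bar B^{**}$ and $f\in H(B)$. If $\hat f$ is constant on the fiber $M_{x_0^{**}}$, then $f$ extends to a norm-continuous function $f_0$ on $B\cup\{x_0^{**}\}$ which is $w(X^{**},X^* )$-continuous at $x_0^{**}$ (i.e. $f(x_\alpha)\to f_0(x_0^{**})$ for every net $(x_\alpha)\subset B$ weak-star converging to $x_0^{**}$).
   Context: $H^\infty(B)$: bounded holomorphic functions on $B$ with sup norm; $A_u(B)$: uniformly continuous holomorphic functions on $B$; a uniform algebra between them is a closed unital subalgebra of $H^\infty(B)$ containing $A_u(B)$. $M_{H(B)}$ is its spectrum (weak-star topology), $\hat f$ the Gelfand transform. $\bar B^{**}$ is the closed unit ball of $X^{**}$. The (original) fiber over $x^{**}\in\bar B^{**}$ is $M_{x^{**}}=\pi^{-1}(x^{**})$, where $\pi:M_{H(B)}\to\bar B^{**}$, $\pi(\tau)=\tau|_{X^*}$ (identifying a point of $\bar B^{**}$ with the character $L\mapsto x^{**}(L)$ on $X^*$), i.e. $M_{x^{**}}=\{\tau\in M_{H(B)}:\tau(L)=x^{**}(L)\ \forall L\in X^*\}$. *)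

theory Defs
  imports "HOL-Analysis.Analysis"
begin

text \<open>A complex Banach space is modelled as a real Banach space (type class banach)
  together with a complex structure J (multiplication by i).\<close>

definition cscale :: "('a::real_vector \<Rightarrow> 'a) \<Rightarrow> complex \<Rightarrow> 'a \<Rightarrow> 'a" where
  "cscale J c x = Re c *\<^sub>R x + Im c *\<^sub>R J x"

definition complex_structure :: "('a::real_normed_vector \<Rightarrow> 'a) \<Rightarrow> bool" where
  "complex_structure J \<longleftrightarrow> linear J \<and> (\<forall>x. J (J x) = - x) \<and>
     (\<forall>c x. norm (cscale J c x) = cmod c * norm x)"

abbreviation unitB :: "'a::real_normed_vector set" where
  "unitB \<equiv> ball 0 1"

definition cdual :: "('a::real_normed_vector \<Rightarrow> 'a) \<Rightarrow> ('a \<Rightarrow> complex) set" where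
  "cdual J = {L. (\<forall>x y. L (x + y) = L x + L y) \<and> (\<forall>c x. L (cscale J c x) = c * L x)
                 \<and> (\<exists>K. \<forall>x. cmod (L x) \<le> K * norm x)}"

text \<open>Closed unit ball of X**: complex-linear functionals on X* of norm at most 1
  (taken extensionally zero outside X*).\<close>
definition bidual_ball :: "('a::real_normed_vector \<Rightarrow> 'a) \<Rightarrow> (('a \<Rightarrow> complex) \<Rightarrow> complex) set" where
  "bidual_ball J = {\<Phi>. (\<forall>L\<in>cdual J. \<forall>M\<in>cdual J. \<Phi> (\<lambda>x. L x + M x) = \<Phi> L + \<Phi> M)
      \<and> (\<forall>c. \<forall>L\<in>cdual J. \<Phi> (\<lambda>x. c * L x) = c * \<Phi> L)
      \<and> (\<forall>L\<in>cdual J. \<forall>K\<ge>0. (\<forall>x. cmod (L x) \<le> K * norm x) \<longrightarrow> cmod (\<Phi> L) \<le> K)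
      \<and> (\<forall>L. L \<notin> cdual J \<longrightarrow> \<Phi> L = 0)}"

definition holo :: "('a::real_normed_vector \<Rightarrow> 'a) \<Rightarrow> 'a set \<Rightarrow> ('a \<Rightarrow> complex) \<Rightarrow> bool" where
  "holo J U f \<longleftrightarrow> (\<forall>x\<in>U. \<exists>D. (f has_derivative D) (at x) \<and> (\<forall>c y. D (cscale J c y) = c * D y))"

text \<open>Functions on B are represented extensionally (value 0 outside B).\<close>
definition Hinf :: "('a::real_normed_vector \<Rightarrow> 'a) \<Rightarrow> ('a \<Rightarrow> complex) set" where
  "Hinf J = {f. holo J unitB f \<and> bounded (f ` unitB) \<and> (\<forall>x. x \<notin> unitB \<longrightarrow> f x = 0)}"

definition Au :: "('a::real_normed_vector \<Rightarrow> 'a) \<Rightarrow> ('a \<Rightarrow> complex) set" where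
  "Au J = {f \<in> Hinf J. uniformly_continuous_on unitB f}"

definition restrB :: "('a::real_normed_vector \<Rightarrow> complex) \<Rightarrow> 'a \<Rightarrow> complex" where
  "restrB g = (\<lambda>x. if x \<in> unitB then g x else 0)"

definition uniform_algebra_between :: "('a::real_normed_vector \<Rightarrow> 'a) \<Rightarrow> ('a \<Rightarrow> complex) set \<Rightarrow> bool" where
  "uniform_algebra_between J H \<longleftrightarrow> Au J \<subseteq> H \<and> H \<subseteq> Hinf J
     \<and> (\<forall>f\<in>H. \<forall>g\<in>H. (\<lambda>x. f x + g x) \<in> H \<and> (\<lambda>x. f x * g x) \<in> H)
     \<and> (\<forall>c. \<forall>f\<in>H. (\<lambda>x. c * f x) \<in> H)
     \<and> restrB (\<lambda>_. 1) \<in> H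
     \<and> (\<forall>g\<in>Hinf J. (\<forall>e>0. \<exists>f\<in>H. \<forall>x\<in>unitB. cmod (f x - g x) < e) \<longrightarrow> g \<in> H)"

definition spectrumH :: "('a::real_normed_vector \<Rightarrow> complex) set \<Rightarrow> (('a \<Rightarrow> complex) \<Rightarrow> complex) set" where
  "spectrumH H = {\<tau>. (\<forall>f\<in>H. \<forall>g\<in>H. \<tau> (\<lambda>x. f x + g x) = \<tau> f + \<tau> g
                        \<and> \<tau> (\<lambda>x. f x * g x) = \<tau> f * \<tau> g)
      \<and> (\<forall>c. \<forall>f\<in>H. \<tau> (\<lambda>x. c * f x) = c * \<tau> f)
      \<and> \<tau> (restrB (\<lambda>_. 1)) = 1
      \<and> (\<forall>f. f \<notin> H \<longrightarrow> \<tau> f = 0)}"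

definition fiber :: "('a::real_normed_vector \<Rightarrow> 'a) \<Rightarrow> ('a \<Rightarrow> complex) set \<Rightarrow> (('a \<Rightarrow> complex) \<Rightarrow> complex)
                     \<Rightarrow> (('a \<Rightarrow> complex) \<Rightarrow> complex) set" where
  "fiber J H \<Phi> = {\<tau> \<in> spectrumH H. \<forall>L\<in>cdual J. \<tau> (restrB L) = \<Phi> L}"

definition gelfand :: "('a \<Rightarrow> complex) \<Rightarrow> (('a \<Rightarrow> complex) \<Rightarrow> complex) \<Rightarrow> complex" where
  "gelfand f \<tau> = \<tau> f"

end

theory Submission imports Defs begin

text \<open>Let \<open>F\<close> be any filter on \<open>B\<close> along which every \<open>L \<in> X*\<close> tends to \<open>x\<^sub>0**(L)\<close>
  (e.g. the image of a net weak-star converging to \<open>x\<^sub>0**\<close>), and refine it to an ultrafilter \<open>U\<close>.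
  Every bounded function converges along \<open>U\<close>, so \<open>g \<mapsto> lim\<^sub>U g\<close> is a character of \<open>H(B)\<close>;
  it agrees with \<open>x\<^sub>0**\<close> on \<open>X*\<close>, i.e. it lies in the fiber, so \<open>lim\<^sub>U f\<close> is the constant value
  \<open>c\<close> of \<open>f\<^sup>^\<close> there. As all ultrafilter refinements of \<open>F\<close> send \<open>f\<close> to \<open>c\<close>, so does \<open>F\<close>.\<close>

definition is_ultrafilter :: "'a filter \<Rightarrow> bool" where
  "is_ultrafilter U \<longleftrightarrow> U \<noteq> bot \<and> (\<forall>P. eventually P U \<or> eventually (\<lambda>x. \<not> P x) U)"

lemma maximal_proper_filter_is_ultrafilter:
  assumes "F \<noteq> bot" and max: "\<And>G. G \<noteq> bot \<Longrightarrow> G \<le> F \<Longrightarrow> F = G"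
  shows "is_ultrafilter F"
  unfolding is_ultrafilter_def
proof (intro conjI allI assms(1) disjCI)
  fix P assume "\<not> (\<forall>\<^sub>F x in F. \<not> P x)"
  then have "inf F (principal {x. P x}) \<noteq> bot"
    by (simp add: trivial_limit_def eventually_inf_principal not_eventually)
  then have F: "F = inf F (principal {x. P x})" by (rule max) simp
  show "eventually P F" by (subst F) (simp add: eventually_inf_principal)
qed

lemma exists_ultrafilter_le:
  fixes F :: "'a filter"
  assumes F: "F \<noteq> bot"
  shows "\<exists>U\<le>F. is_ultrafilter U"
proof -
  let ?R = "{(b, a). a \<noteq> bot \<and> a \<le> b \<and> b \<le> F}"
  have bot_notin_chain: "c \<in> Chains ?R \<Longrightarrow> bot \<notin> c" for c
    by (auto simp: Chains_def)
  have [simp]: "Field ?R = {G. G \<noteq> bot \<and> G \<le> F}"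
    by (auto simp: Field_def bot_unique)
  have "\<exists>m\<in>Field ?R. \<forall>a\<in>Field ?R. (m, a) \<in> ?R \<longrightarrow> a = m" (is "\<exists>m\<in>?A. ?B m")
  proof (rule Zorns_po_lemma)
    show "Partial_order ?R"
      by (auto simp: partial_order_on_def preorder_on_def
          antisym_def refl_on_def trans_def Field_def bot_unique)
    show "\<exists>u\<in>Field ?R. \<forall>a\<in>C. (a, u) \<in> ?R" if C: "C \<in> Chains ?R" for C
    proof (simp, intro exI conjI ballI)
      have Inf_C: "Inf C \<noteq> bot" "Inf C \<le> F" if "C \<noteq> {}"
      proof -
        from C that have "Inf C = bot \<longleftrightarrow> (\<exists>x\<in>C. x = bot)"
          unfolding trivial_limit_def by (intro eventually_Inf_base) (auto simp: Chains_def)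
        with C show "Inf C \<noteq> bot"
          by (simp add: bot_notin_chain)
        from that obtain x where "x \<in> C" by auto
        with C show "Inf C \<le> F"
          by (auto intro!: Inf_lower2[of x] simp: Chains_def)
      qed
      then have [simp]: "inf F (Inf C) = (if C = {} then F else Inf C)"
        using C by (auto simp add: inf_absorb2)
      from C show "inf F (Inf C) \<noteq> bot"
        by (simp add: F Inf_C)
      from C show "inf F (Inf C) \<le> F"
        by (simp add: Chains_def Inf_C F)
      with C show "inf F (Inf C) \<le> x" "x \<le> F" if "x \<in> C" for x
        using that by (auto intro: Inf_lower simp: Chains_def)
    qed
  qed
  then obtain U where U: "U \<in> ?A" "?B U" ..
  then show ?thesis
    by (auto intro!: exI[of _ U] maximal_proper_filter_is_ultrafilter)
qed

lemma tendsto_if_tendsto_ultrafilters_le: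
  assumes "\<And>U. is_ultrafilter U \<Longrightarrow> U \<le> F \<Longrightarrow> (f \<longlongrightarrow> c) U"
  shows "(f \<longlongrightarrow> c) F"
  unfolding tendsto_def
proof (intro allI impI)
  fix S assume S: "open S" "c \<in> S"
  show "eventually (\<lambda>x. f x \<in> S) F"
  proof (rule ccontr)
    assume "\<not> ?thesis"
    then have "inf F (principal {x. f x \<notin> S}) \<noteq> bot"
      by (simp add: trivial_limit_def eventually_inf_principal not_eventually)
    then obtain U where U_le: "U \<le> inf F (principal {x. f x \<notin> S})" and U: "is_ultrafilter U"
      using exists_ultrafilter_le by blast
    then have "eventually (\<lambda>x. f x \<in> S) U"
      using assms S by (simp add: tendsto_def)
    moreover have "eventually (\<lambda>x. f x \<notin> S) U"
      by (rule filter_leD[OF U_le]) (simp add: eventually_inf_principal)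
    ultimately have "eventually (\<lambda>x. False) U" by (rule eventually_elim2) auto
    with U show False by (simp add: is_ultrafilter_def trivial_limit_def)
  qed
qed

lemma ultrafilter_tendsto_in_compact:
  assumes U: "is_ultrafilter U" and K: "compact K" and ev: "eventually (\<lambda>x. g x \<in> K) U"
  shows "\<exists>l. (g \<longlongrightarrow> l) U"
proof -
  have "filtermap g U \<noteq> bot" using U by (simp add: is_ultrafilter_def filtermap_bot_iff)
  then obtain l where l: "inf (nhds l) (filtermap g U) \<noteq> bot"
    using K[unfolded compact_filter] ev by (auto simp: eventually_filtermap)
  have "(g \<longlongrightarrow> l) U"
    unfolding tendsto_def
  proof (intro allI impI)
    fix S assume S: "open S" "l \<in> S"
    show "eventually (\<lambda>x. g x \<in> S) U"
    proof (rule ccontr)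
      assume "\<not> ?thesis"
      with U have "eventually (\<lambda>y. y \<notin> S) (filtermap g U)"
        by (auto simp: is_ultrafilter_def eventually_filtermap)
      moreover have "eventually (\<lambda>y. y \<in> S) (nhds l)" using S eventually_nhds by blast
      ultimately have "eventually (\<lambda>y. False) (inf (nhds l) (filtermap g U))"
        unfolding eventually_inf by blast
      with l show False by (simp add: trivial_limit_def)
    qed
  qed
  then show ?thesis by blast
qed

lemma ultrafilter_tendsto_bounded:
  fixes g :: "'a \<Rightarrow> 'b::heine_borel"
  assumes U: "is_ultrafilter U" and ev: "eventually (\<lambda>x. x \<in> A) U" and b: "bounded (g ` A)"
  shows "\<exists>l. (g \<longlongrightarrow> l) U"
proof (rule ultrafilter_tendsto_in_compact[OF U])
  show "compact (closure (g ` A))" using b by (simp add: compact_eq_bounded_closed bounded_closure)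
  show "eventually (\<lambda>x. g x \<in> closure (g ` A)) U"
    using ev by (rule eventually_mono) (auto intro: closure_subset[THEN subsetD])
qed

lemma cdual_bounded_linear:
  assumes "L \<in> cdual J"
  shows "bounded_linear L"
proof -
  from assms have add: "\<And>x y. L (x + y) = L x + L y"
    and scale: "\<And>c x. L (cscale J c x) = c * L x"
    and "\<exists>K. \<forall>x. cmod (L x) \<le> K * norm x" unfolding cdual_def by auto
  then obtain K where K: "\<And>x. cmod (L x) \<le> K * norm x" by blast
  have "L (r *\<^sub>R x) = r *\<^sub>R L x" for r x
    using scale[of "complex_of_real r" x] by (simp add: cscale_def scaleR_conv_of_real)
  with add K show ?thesis
    by (intro bounded_linear_intro[where K=K]) (auto simp: mult.commute)
qed

lemma restrB_cdual_in_Au: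
  assumes L: "L \<in> cdual J"
  shows "restrB L \<in> Au J"
proof -
  have bl: "bounded_linear L" by (rule cdual_bounded_linear[OF L])
  from L have scale: "\<And>c x. L (cscale J c x) = c * L x" unfolding cdual_def by auto
  have on_B: "\<And>x. x \<in> unitB \<Longrightarrow> restrB L x = L x" by (simp add: restrB_def)
  have "(restrB L has_derivative L) (at x)" if "x \<in> unitB" for x
    using has_derivative_transform_within_open[OF bounded_linear_imp_has_derivative[OF bl]
        open_ball that] by (simp add: on_B)
  then have "holo J unitB (restrB L)"
    using scale unfolding holo_def by blast
  moreover have "bounded (restrB L ` unitB)"
  proof -
    have "bounded (L ` unitB)"
      by (rule bounded_linear_image[OF bounded_ball bl])
    then show ?thesis
      by (rule bounded_subset) (auto simp: on_B)
  qed
  moreover have "uniformly_continuous_on unitB (restrB L)"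
    using bounded_linear.uniformly_continuous_on[OF bl uniformly_continuous_on_id]
    by (simp add: uniformly_continuous_on_def on_B)
  ultimately show ?thesis unfolding Au_def Hinf_def by (simp add: restrB_def)
qed

lemma holo_continuous_on:
  assumes "holo J U f" shows "continuous_on U f"
proof (rule continuous_at_imp_continuous_on, rule ballI)
  fix x assume "x \<in> U"
  then obtain D where "(f has_derivative D) (at x)" using assms by (auto simp: holo_def)
  then show "isCont f x" by (rule has_derivative_continuous)
qed

text \<open>The point of \<open>M\<^bsub>H(B)\<^esub>\<close> to which an ultrafilter \<open>U\<close> on \<open>B\<close> converges; it is \<open>0\<close> off \<open>H\<close>,
  as the extensional convention of \<open>spectrumH\<close> demands.\<close>

definition ultralimit_character :: "'a filter \<Rightarrow> ('a \<Rightarrow> complex) set \<Rightarrow> ('a \<Rightarrow> complex) \<Rightarrow> complex" where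
  "ultralimit_character U H g = (if g \<in> H then Lim U g else 0)"

context
  fixes J :: "'a::real_normed_vector \<Rightarrow> 'a" and H :: "('a \<Rightarrow> complex) set"
    and U :: "'a filter"
  assumes H: "uniform_algebra_between J H"
    and U: "is_ultrafilter U" and U_B: "eventually (\<lambda>x. x \<in> unitB) U"
begin

lemma tendsto_ultralimit_character:
  assumes "g \<in> H" shows "(g \<longlongrightarrow> ultralimit_character U H g) U"
proof -
  have "U \<noteq> bot" using U by (simp add: is_ultrafilter_def)
  moreover have "bounded (g ` unitB)"
    using assms H by (auto simp: uniform_algebra_between_def Hinf_def)
  then obtain l where "(g \<longlongrightarrow> l) U" using ultrafilter_tendsto_bounded[OF U U_B] by blast
  ultimately show ?thesis using assms by (simp add: ultralimit_character_def tendsto_Lim)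
qed

lemma ultralimit_character_eqI:
  assumes "g \<in> H" "(g \<longlongrightarrow> l) U" shows "ultralimit_character U H g = l"
  using U assms tendsto_ultralimit_character
  by (auto simp: is_ultrafilter_def intro: tendsto_unique)

lemma ultralimit_character_eqI_on_ball:
  assumes "g \<in> H" "(h \<longlongrightarrow> l) U" "\<And>x. x \<in> unitB \<Longrightarrow> g x = h x"
  shows "ultralimit_character U H g = l"
proof (rule ultralimit_character_eqI[OF assms(1)])
  show "(g \<longlongrightarrow> l) U"
    using assms(2) by (rule Lim_transform_eventually) (use U_B assms(3) in \<open>auto elim: eventually_mono\<close>)
qed

lemma ultralimit_character_in_spectrum:
  "ultralimit_character U H \<in> spectrumH H"
proof -
  from H have closed: "\<forall>f\<in>H. \<forall>g\<in>H. (\<lambda>x. f x + g x) \<in> H \<and> (\<lambda>x. f x * g x) \<in> H"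
    and scale: "\<forall>c. \<forall>f\<in>H. (\<lambda>x. c * f x) \<in> H" and one: "restrB (\<lambda>_. 1) \<in> H"
    unfolding uniform_algebra_between_def by auto
  note lim = tendsto_ultralimit_character and eq = ultralimit_character_eqI
  show ?thesis
    unfolding spectrumH_def
  proof (intro CollectI conjI ballI allI impI)
    fix g h assume "g \<in> H" "h \<in> H"
    then show "ultralimit_character U H (\<lambda>x. g x + h x)
                 = ultralimit_character U H g + ultralimit_character U H h"
      and "ultralimit_character U H (\<lambda>x. g x * h x)
                 = ultralimit_character U H g * ultralimit_character U H h"
      using closed by (auto intro!: eq tendsto_add tendsto_mult lim)
  next
    fix a g assume "g \<in> H"
    then show "ultralimit_character U H (\<lambda>x. a * g x) = a * ultralimit_character U H g"
      using scale by (auto intro!: eq tendsto_mult lim)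
  next
    show "ultralimit_character U H (restrB (\<lambda>_. 1)) = 1"
      by (rule ultralimit_character_eqI_on_ball[OF one tendsto_const]) (simp add: restrB_def)
  qed (simp add: ultralimit_character_def)
qed

lemma ultralimit_character_in_fiber:
  assumes "\<forall>L\<in>cdual J. (L \<longlongrightarrow> \<Phi> L) U"
  shows "ultralimit_character U H \<in> fiber J H \<Phi>"
proof -
  have "restrB L \<in> H" if "L \<in> cdual J" for L
    using H restrB_cdual_in_Au[OF that] by (auto simp: uniform_algebra_between_def)
  then have "ultralimit_character U H (restrB L) = \<Phi> L" if "L \<in> cdual J" for L
    using that assms by (auto intro: ultralimit_character_eqI_on_ball simp: restrB_def)
  then show ?thesis
    by (simp add: fiber_def ultralimit_character_in_spectrum)
qed

end

lemma tendsto_of_constant_on_fiber: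
  assumes H: "uniform_algebra_between J H" and "f \<in> H"
    and const: "\<forall>\<tau>\<in>fiber J H \<Phi>. gelfand f \<tau> = c"
    and F_B: "eventually (\<lambda>x. x \<in> unitB) F" and weak_star: "\<forall>L\<in>cdual J. (L \<longlongrightarrow> \<Phi> L) F"
  shows "(f \<longlongrightarrow> c) F"
proof (rule tendsto_if_tendsto_ultrafilters_le)
  fix U assume U: "is_ultrafilter U" and "U \<le> F"
  then have U_B: "eventually (\<lambda>x. x \<in> unitB) U" and "\<forall>L\<in>cdual J. (L \<longlongrightarrow> \<Phi> L) U"
    using F_B weak_star by (auto intro: filter_leD tendsto_mono)
  then have "ultralimit_character U H f = c"
    using ultralimit_character_in_fiber[OF H U U_B] const by (simp add: gelfand_def)
  with tendsto_ultralimit_character[OF H U U_B \<open>f \<in> H\<close>] show "(f \<longlongrightarrow> c) U" by simp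
qed

lemma cdual_normalize:
  assumes L: "L \<in> cdual J"
  obtains K :: real where "K > 0" "(\<lambda>x. of_real (1 / K) * L x) \<in> cdual J"
    "\<And>y. cmod (of_real (1 / K) * L y) \<le> norm y"
proof -
  from L obtain K where K: "\<And>x. cmod (L x) \<le> K * norm x" unfolding cdual_def by blast
  define K' where "K' = max K 1"
  have "K' > 0" by (simp add: K'_def)
  have bound: "cmod (of_real (1 / K') * L y) \<le> norm y" for y
  proof -
    have "cmod (L y) \<le> K' * norm y"
      using K[of y] by (smt (verit) K'_def mult_right_mono norm_ge_zero)
    then show ?thesis using \<open>K' > 0\<close> by (simp add: norm_divide divide_le_eq mult.commute)
  qed
  have "(\<lambda>x. of_real (1 / K') * L x) \<in> cdual J"
    using L bound unfolding cdual_def by (auto simp: algebra_simps add_divide_distrib intro!: exI[of _ 1])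
  with \<open>K' > 0\<close> bound show ?thesis by (blast intro: that)
qed

lemma weak_star_tendsto_of_uniform_on_unit_ball:
  assumes \<Phi>: "\<Phi> \<in> bidual_ball J"
    and unif: "\<forall>e>0. eventually (\<lambda>x. \<forall>L\<in>cdual J. (\<forall>y. cmod (L y) \<le> norm y)
                                       \<longrightarrow> cmod (L x - \<Phi> L) \<le> e) F"
  shows "\<forall>L\<in>cdual J. (L \<longlongrightarrow> \<Phi> L) F"
proof
  fix L assume L: "L \<in> cdual J"
  obtain K :: real where K: "K > 0" and L'_dual: "(\<lambda>x. of_real (1 / K) * L x) \<in> cdual J"
    and L'_unit: "\<And>y. cmod (of_real (1 / K) * L y) \<le> norm y"
    using cdual_normalize[OF L] by blast
  define L' where "L' = (\<lambda>x. of_real (1 / K) * L x)"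
  have \<Phi>_L': "\<Phi> L' = of_real (1 / K) * \<Phi> L"
    using \<Phi> L unfolding bidual_ball_def L'_def by blast
  have "(L' \<longlongrightarrow> \<Phi> L') F"
    unfolding tendsto_iff dist_norm
  proof (intro allI impI)
    fix e :: real assume "e > 0"
    then show "eventually (\<lambda>x. cmod (L' x - \<Phi> L') < e) F"
      using unif[rule_format, of "e / 2"] L'_dual L'_unit
      by (auto simp: L'_def elim!: eventually_mono)
  qed
  then have "((\<lambda>x. of_real K * L' x) \<longlongrightarrow> of_real K * \<Phi> L') F"
    by (rule tendsto_mult_left)
  moreover have "(\<lambda>x. of_real K * L' x) = L" using K by (simp add: L'_def)
  moreover have "of_real K * \<Phi> L' = \<Phi> L" using K by (simp add: \<Phi>_L')
  ultimately show "(L \<longlongrightarrow> \<Phi> L) F" by simp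
qed

theorem mainTheorem3:
  fixes J :: "'a::banach \<Rightarrow> 'a" and H :: "('a \<Rightarrow> complex) set"
    and \<Phi> :: "('a \<Rightarrow> complex) \<Rightarrow> complex" and f :: "'a \<Rightarrow> complex"
  assumes "complex_structure J"
    and "uniform_algebra_between J H"
    and "\<Phi> \<in> bidual_ball J"
    and "f \<in> H"
    and "\<exists>c. \<forall>\<tau>\<in>fiber J H \<Phi>. gelfand f \<tau> = c"
  shows "\<exists>w. continuous_on unitB f
    \<and> (\<forall>F. eventually (\<lambda>x. x \<in> unitB) F
          \<and> (\<forall>e>0. eventually (\<lambda>x. \<forall>L\<in>cdual J. (\<forall>y. cmod (L y) \<le> norm y)
                                       \<longrightarrow> cmod (L x - \<Phi> L) \<le> e) F)
          \<longrightarrow> (f \<longlongrightarrow> w) F)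
    \<and> (\<forall>F. eventually (\<lambda>x. x \<in> unitB) F \<and> (\<forall>L\<in>cdual J. (L \<longlongrightarrow> \<Phi> L) F)
          \<longrightarrow> (f \<longlongrightarrow> w) F)"
proof -
  obtain c where c: "\<forall>\<tau>\<in>fiber J H \<Phi>. gelfand f \<tau> = c" using assms(5) by blast
  have "continuous_on unitB f"
    using assms(2,4) by (intro holo_continuous_on) (auto simp: uniform_algebra_between_def Hinf_def)
  moreover note tendsto_of_constant_on_fiber[OF assms(2,4) c]
  ultimately show ?thesis
    using weak_star_tendsto_of_uniform_on_unit_ball[OF assms(3)] by blast
qed

end
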